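(* Let $X\subset\mathbb{C}^{n}$ be a domain and let $L,M:X\times X\to\mathbb{C}$ be holomorphic non-degenerate bi-functions on $X$. Then $L$ and $M$ are symmetric rescalings if and only if there is a somewhere dense set $U\subset X$ such that $$\frac{L(x,y)^{2}}{L(x,x)L(y,y)}=\frac{M(x,y)^{2}}{M(x,x)M(y,y)}\quad\text{for every }x,y\in U.$$
   Context: A domain is an open connected set. A bi-function on $X$ is a function $X\times X\to\mathbb{C}$; it is holomorphic if it is a holomorphic function on $X\times X\subset\mathbb{C}^{2n}$, and non-degenerate if $L(x,x)\neq0$ for every $x\in X$. A set is somewhere dense if its closure has nonempty interior. $L$ and $M$ are symmetric rescalings if there is a function $f:X\to\mathbb{C}\setminus\{0\}$ with $M(x,y)=f(x)f(y)L(x,y)$ for all $x,y\in X$. *)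

theory Defs
  imports "HOL-Analysis.Analysis"
begin

(* Nonemptiness is part of the usual meaning of "domain" and is essential here:
   the empty set has no somewhere dense subset. *)
definition is_domain :: "(complex ^ 'n) set \<Rightarrow> bool" where
  "is_domain X \<longleftrightarrow> open X \<and> connected X \<and> X \<noteq> {}"

(* Bi-functions are curried and total; only their values on X \<times> X matter.
   (complex ^ 'n) \<times> (complex ^ 'n) plays the role of C^(2n), so holomorphic means having, at
   every point of X \<times> X, a (real) Frechet derivative that is moreover complex-linear.
   The derivative is two-sided ("at", not "at within"), as X \<times> X is open for a domain X. *)
definition holomorphic_bifun :: "(complex ^ 'n) set \<Rightarrow> (complex ^ 'n \<Rightarrow> complex ^ 'n \<Rightarrow> complex) \<Rightarrow> bool" where
  "holomorphic_bifun X L \<longleftrightarrow>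
     (\<forall>x\<in>X. \<forall>y\<in>X. \<exists>D. ((\<lambda>(u, v). L u v) has_derivative D) (at (x, y)) \<and>
        (\<forall>c u v. D (c *s u, c *s v) = c * D (u, v)))"

definition nondegenerate_bifun :: "'a set \<Rightarrow> ('a \<Rightarrow> 'a \<Rightarrow> complex) \<Rightarrow> bool" where
  "nondegenerate_bifun X L \<longleftrightarrow> (\<forall>x\<in>X. L x x \<noteq> 0)"

definition somewhere_dense :: "'a::topological_space set \<Rightarrow> bool" where
  "somewhere_dense U \<longleftrightarrow> interior (closure U) \<noteq> {}"

definition symmetric_rescalings ::
    "'a set \<Rightarrow> ('a \<Rightarrow> 'a \<Rightarrow> complex) \<Rightarrow> ('a \<Rightarrow> 'a \<Rightarrow> complex) \<Rightarrow> bool" where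
  "symmetric_rescalings X L M \<longleftrightarrow>
     (\<exists>f. (\<forall>x\<in>X. f x \<noteq> 0) \<and> (\<forall>x\<in>X. \<forall>y\<in>X. M x y = f x * f y * L x y))"

end

theory Submission
  imports Defs "HOL-Complex_Analysis.Conformal_Mappings"
begin

text \<open>
  Cross-multiplied, the hypothesis is an equation between functions that are holomorphic in each
  variable, so it spreads from a somewhere dense set to all of \<open>X\<close>, giving
  \<open>M(x,y)\<^sup>2 = h(x) h(y) L(x,y)\<^sup>2\<close> with \<open>h(x) = M(x,x) / L(x,x)\<close>. As \<open>X\<close> need not be simply connected,
  a square root \<open>f\<close> of \<open>h\<close> is not taken directly. Fix a base point \<open>a\<close> and put
  \<open>f(x) = \<surd>h(a) \<cdot> M(x,z) L(a,z) / (M(a,z) L(x,z))\<close> for any \<open>z\<close> with \<open>L(x,z) L(a,z) \<noteq> 0\<close>.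
  The identity \<open>M(x,y) = f(x) f(y) L(x,y)\<close> then clears denominators to an identity \<open>A = B\<close> in the four
  variables \<open>x, y, z, w\<close>. It holds up to sign because \<open>A\<^sup>2 = B\<^sup>2\<close>; near the diagonal point
  \<open>(a,a,a,a)\<close>, where \<open>A = B \<noteq> 0\<close>, the sign is \<open>+\<close>, and the identity theorem in one variable at a
  time extends this to all of \<open>X\<close>.
\<close>

section \<open>Holomorphic functions of one vector variable\<close>

definition vec_holomorphic_on :: "(complex ^ 'n \<Rightarrow> complex) \<Rightarrow> (complex ^ 'n) set \<Rightarrow> bool" where
  "vec_holomorphic_on F X \<longleftrightarrow>
     (\<forall>x\<in>X. \<exists>D. (F has_derivative D) (at x) \<and> (\<forall>c v. D (c *s v) = c * D v))"

named_theorems vec_holomorphic_intros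

lemma vec_holomorphic_on_const [vec_holomorphic_intros]: "vec_holomorphic_on (\<lambda>x. c) X"
  unfolding vec_holomorphic_on_def
  by (intro ballI exI[of _ "\<lambda>_. 0"]) auto

lemma vec_holomorphic_on_diff [vec_holomorphic_intros]:
  assumes "vec_holomorphic_on F X" "vec_holomorphic_on G X"
  shows "vec_holomorphic_on (\<lambda>x. F x - G x) X"
  unfolding vec_holomorphic_on_def
proof
  fix x assume "x \<in> X"
  with assms obtain D E
    where D: "(F has_derivative D) (at x)" "\<And>c v. D (c *s v) = c * D v"
      and E: "(G has_derivative E) (at x)" "\<And>c v. E (c *s v) = c * E v"
    unfolding vec_holomorphic_on_def by meson
  show "\<exists>D. ((\<lambda>x. F x - G x) has_derivative D) (at x) \<and> (\<forall>c v. D (c *s v) = c * D v)"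
    using has_derivative_diff[OF D(1) E(1)] D(2) E(2)
    by (intro exI[of _ "\<lambda>v. D v - E v"]) (auto simp: algebra_simps)
qed

lemma vec_holomorphic_on_mult [vec_holomorphic_intros]:
  assumes "vec_holomorphic_on F X" "vec_holomorphic_on G X"
  shows "vec_holomorphic_on (\<lambda>x. F x * G x) X"
  unfolding vec_holomorphic_on_def
proof
  fix x assume "x \<in> X"
  with assms obtain D E
    where D: "(F has_derivative D) (at x)" "\<And>c v. D (c *s v) = c * D v"
      and E: "(G has_derivative E) (at x)" "\<And>c v. E (c *s v) = c * E v"
    unfolding vec_holomorphic_on_def by meson
  show "\<exists>D. ((\<lambda>x. F x * G x) has_derivative D) (at x) \<and> (\<forall>c v. D (c *s v) = c * D v)"
    using has_derivative_mult[OF D(1) E(1)] D(2) E(2)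
    by (intro exI[of _ "\<lambda>v. F x * E v + D v * G x"]) (auto simp: algebra_simps)
qed

lemma vec_holomorphic_on_power [vec_holomorphic_intros]:
  assumes "vec_holomorphic_on F X"
  shows "vec_holomorphic_on (\<lambda>x. F x ^ k) X"
  by (induction k) (auto intro!: vec_holomorphic_intros assms)

lemma vec_holomorphic_on_imp_continuous_on:
  assumes "vec_holomorphic_on F X"
  shows "continuous_on X F"
  using assms unfolding vec_holomorphic_on_def
  by (meson continuous_at_imp_continuous_on has_derivative_continuous)

text \<open>Complex linearity turns the real derivative \<open>D (t *s v)\<close> along the line
  into \<open>D v * t\<close>, a complex field derivative. This is the passage from several
  variables to one.\<close>

lemma vec_holomorphic_on_line:
  assumes "vec_holomorphic_on F X" and T: "\<And>t. t \<in> T \<Longrightarrow> z + t *s v \<in> X"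
  shows "(\<lambda>t. F (z + t *s v)) holomorphic_on T"
proof (rule holomorphic_onI)
  fix t assume "t \<in> T"
  then obtain D where D: "(F has_derivative D) (at (z + t *s v))" "\<And>c v. D (c *s v) = c * D v"
    using assms unfolding vec_holomorphic_on_def by blast
  have "linear (\<lambda>t. t *s v)"
    by (rule linearI) (auto simp: vec_eq_iff algebra_simps)
  then have "((\<lambda>t. t *s v) has_derivative (\<lambda>t. t *s v)) (at t)"
    by (simp add: linear_conv_bounded_linear bounded_linear_imp_has_derivative)
  then have "((\<lambda>t. z + t *s v) has_derivative (\<lambda>t. t *s v)) (at t)"
    by (auto intro: derivative_eq_intros)
  from has_derivative_compose[OF this D(1)]
  have "((\<lambda>t. F (z + t *s v)) has_derivative (\<lambda>t. D v * t)) (at t)"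
    by (simp add: D(2) mult.commute)
  then have "((\<lambda>t. F (z + t *s v)) has_field_derivative D v) (at t)"
    by (simp add: has_field_derivative_def)
  then show "(\<lambda>t. F (z + t *s v)) field_differentiable at t within T"
    using field_differentiable_at_within field_differentiable_def by blast
qed

section \<open>The identity theorem on open connected sets\<close>

text \<open>The complex line through \<open>z\<close> and \<open>y\<close> meets the ball in an open
  convex set of parameters containing 0 and 1. One-variable continuation carries the vanishing near
  0 to 1.\<close>

lemma vec_holomorphic_zero_on_ball:
  assumes F: "vec_holomorphic_on F (ball x r)"
    and "open Z" "z \<in> Z" "z \<in> ball x r" "y \<in> ball x r" and Z: "\<And>u. u \<in> Z \<Longrightarrow> F u = 0"
  shows "F y = 0"
proof -
  define l where "l t = z + t *s (y - z)" for t :: complex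
  define S where "S = l -` ball x r"
  have lin: "linear (\<lambda>t. t *s (y - z))"
    by (rule linearI) (auto simp: vec_eq_iff algebra_simps)
  have cont: "continuous_on UNIV l"
    unfolding l_def using lin
    by (intro continuous_intros linear_continuous_on) (simp add: linear_conv_bounded_linear)
  have "open S" "open (l -` Z)"
    unfolding S_def using cont \<open>open Z\<close> by (auto intro: open_vimage)
  \<comment> \<open>Translating the ball by \<open>- z\<close> makes the affine preimage a linear
    one, whose convexity is known.\<close>
  have "S = (\<lambda>t. t *s (y - z)) -` ((\<lambda>w. - z + w) ` ball x r)"
    by (auto simp: S_def l_def image_iff intro!: bexI[of _ "z + _ *s (y - z)"])
  then have "convex S"
    using convex_linear_vimage[OF lin convex_translation[OF convex_ball]] by metis
  have "(\<lambda>t. F (l t)) holomorphic_on S"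
    unfolding l_def by (rule vec_holomorphic_on_line[OF F]) (auto simp: S_def l_def)
  have "0 \<in> l -` Z \<inter> S" "1 \<in> S"
    using assms by (auto simp: S_def l_def)
  have "F (l 1) = 0"
  proof (rule analytic_continuation_open[where s = "l -` Z \<inter> S" and s' = S and f = "\<lambda>t. F (l t)" and g = "\<lambda>_. 0"])
    show "open (l -` Z \<inter> S)" using \<open>open S\<close> \<open>open (l -` Z)\<close> by blast
    show "connected S" using \<open>convex S\<close> by (rule convex_connected)
  qed (use \<open>open S\<close> \<open>0 \<in> _\<close> \<open>1 \<in> S\<close> \<open>_ holomorphic_on S\<close> Z in auto)
  then show ?thesis by (simp add: l_def)
qed

text \<open>The interior of the zero set is nonempty by continuity and density, and relatively
  closed by propagation on balls, so connectedness makes it all of \<open>X\<close>.\<close>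

lemma vec_identity_theorem:
  assumes X: "open X" "connected X" and F: "vec_holomorphic_on F X"
    and U: "U \<subseteq> X" "somewhere_dense U" and zero: "\<And>u. u \<in> U \<Longrightarrow> F u = 0"
    and "y \<in> X"
  shows "F y = 0"
proof -
  define Z where "Z = interior {x\<in>X. F x = 0}"
  have "open (X \<inter> F -` (- {0}))"
    using X(1) vec_holomorphic_on_imp_continuous_on[OF F] by (intro continuous_open_preimage) auto
  moreover have "U \<inter> (X \<inter> F -` (- {0})) = {}"
    using zero by auto
  ultimately have "closure U \<inter> (X \<inter> F -` (- {0})) = {}"
    by (metis Int_commute open_Int_closure_eq_empty)
  then have "interior (closure U) \<inter> X \<subseteq> Z"
    unfolding Z_def using X(1) interior_subset[of "closure U"]
    by (intro interior_maximal) auto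
  moreover have "interior (closure U) \<inter> X \<noteq> {}"
  proof -
    \<comment> \<open>\<open>closure U\<close> may leave \<open>X\<close>, but an open set that
      meets it also meets \<open>U\<close>, which lies in \<open>X\<close>.\<close>
    have "interior (closure U) \<inter> closure U \<noteq> {}"
      using U(2) interior_subset[of "closure U"] unfolding somewhere_dense_def by blast
    then show ?thesis
      using U(1) by (simp add: open_Int_closure_eq_empty) blast
  qed
  ultimately have ne: "X \<inter> Z \<noteq> {}" by blast
  have Z0: "F u = 0" if "u \<in> Z" for u
    using that interior_subset unfolding Z_def by blast
  \<comment> \<open>Relative closedness: a ball in \<open>X\<close> around a limit point of
    \<open>Z\<close> contains a point of \<open>Z\<close>, so \<open>F\<close> vanishes on the whole
    ball.\<close>
  have "x \<in> Z" if "x \<in> X" "x \<in> closure Z" for x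
  proof -
    obtain r where r: "r > 0" "ball x r \<subseteq> X"
      using X(1) \<open>x \<in> X\<close> openE by blast
    then obtain z where z: "z \<in> Z" "z \<in> ball x r"
      using \<open>x \<in> closure Z\<close> by (metis closure_approachable dist_commute mem_ball)
    have "vec_holomorphic_on F (ball x r)"
      using F r(2) unfolding vec_holomorphic_on_def by blast
    then have "ball x r \<subseteq> {x\<in>X. F x = 0}"
      using vec_holomorphic_zero_on_ball[of F x r Z z] z Z0 r(2) unfolding Z_def by auto
    then show ?thesis
      unfolding Z_def by (meson r(1) centre_in_ball interior_maximal open_ball subsetD)
  qed
  then have "X \<inter> Z = X \<inter> closure Z"
    using closure_subset by blast
  then have "closedin (top_of_set X) (X \<inter> Z)"
    by (metis closed_closure closedin_closed_Int)
  moreover have "openin (top_of_set X) (X \<inter> Z)"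
    by (simp add: Z_def openin_open_Int)
  ultimately have "X \<inter> Z = X"
    using X(2) ne unfolding connected_clopen by blast
  then show ?thesis using \<open>y \<in> X\<close> Z0 by blast
qed

lemma open_imp_somewhere_dense: "open U \<Longrightarrow> U \<noteq> {} \<Longrightarrow> somewhere_dense U"
  unfolding somewhere_dense_def by (metis closure_subset interior_maximal subset_empty)

text \<open>The left argument is released from \<open>U\<close> to \<open>X\<close> while the right
  one stays in \<open>U\<close>; then the right one follows.\<close>

lemma vec_identity_theorem_2:
  assumes X: "open X" "connected X" and U: "U \<subseteq> X" "somewhere_dense U"
    and 1: "\<And>y. y \<in> X \<Longrightarrow> vec_holomorphic_on (\<lambda>x. F x y) X"
    and 2: "\<And>x. x \<in> X \<Longrightarrow> vec_holomorphic_on (\<lambda>y. F x y) X"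
    and zero: "\<And>x y. x \<in> U \<Longrightarrow> y \<in> U \<Longrightarrow> F x y = 0"
    and "x \<in> X" "y \<in> X"
  shows "F x y = 0"
proof (rule vec_identity_theorem[OF X 2 U])
  fix u assume "u \<in> U"
  then show "F x u = 0"
    using vec_identity_theorem[OF X 1 U] zero \<open>x \<in> X\<close> U(1) by blast
qed fact+

text \<open>There are no zero divisors: otherwise \<open>G\<close> would vanish on the nonempty open
  set where \<open>F\<close> does not, hence at \<open>b\<close>.\<close>

lemma vec_holomorphic_mult_nonzero:
  assumes X: "open X" "connected X" and F: "vec_holomorphic_on F X" and G: "vec_holomorphic_on G X"
    and "a \<in> X" "F a \<noteq> 0" "b \<in> X" "G b \<noteq> 0"
  shows "\<exists>z\<in>X. F z \<noteq> 0 \<and> G z \<noteq> 0"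
proof (rule ccontr)
  assume none: "\<not> ?thesis"
  have "open (X \<inter> F -` (- {0}))"
    using X(1) vec_holomorphic_on_imp_continuous_on[OF F] by (intro continuous_open_preimage) auto
  then have "somewhere_dense (X \<inter> F -` (- {0}))"
    using assms(5,6) by (intro open_imp_somewhere_dense) auto
  moreover have "G u = 0" if "u \<in> X \<inter> F -` (- {0})" for u
    using that none by auto
  ultimately have "G b = 0"
    using vec_identity_theorem[OF X G Int_lower1] \<open>b \<in> X\<close> by blast
  with assms show False by blast
qed

section \<open>Slices, diagonal and joint continuity of bi-functions\<close>

text \<open>The derivatives \<open>g'\<close> and \<open>k'\<close> do not depend on the point.
  Identity and constant maps have this form, which covers both slices and the diagonal.\<close>

lemma holomorphic_bifun_compose:
  assumes "holomorphic_bifun X L" and g: "\<And>x. x \<in> X \<Longrightarrow> g x \<in> X \<and> k x \<in> X"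
    and "\<And>x. x \<in> X \<Longrightarrow> (g has_derivative g') (at x)" "\<And>c v. g' (c *s v) = c *s g' v"
    and "\<And>x. x \<in> X \<Longrightarrow> (k has_derivative k') (at x)" "\<And>c v. k' (c *s v) = c *s k' v"
  shows "vec_holomorphic_on (\<lambda>x. L (g x) (k x)) X"
  unfolding vec_holomorphic_on_def
proof
  fix x assume x: "x \<in> X"
  with assms(1) g obtain D where D: "((\<lambda>(u, v). L u v) has_derivative D) (at (g x, k x))"
      "\<And>c u v. D (c *s u, c *s v) = c * D (u, v)"
    unfolding holomorphic_bifun_def by metis
  have "((\<lambda>x. L (g x) (k x)) has_derivative (\<lambda>v. D (g' v, k' v))) (at x)"
    using has_derivative_compose[OF has_derivative_Pair[OF assms(3)[OF x] assms(5)[OF x]] D(1)] by simp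
  with D(2) assms(4,6)
  show "\<exists>D. ((\<lambda>x. L (g x) (k x)) has_derivative D) (at x) \<and> (\<forall>c v. D (c *s v) = c * D v)"
    by (intro exI[of _ "\<lambda>v. D (g' v, k' v)"]) simp
qed

lemma
  assumes "holomorphic_bifun X L"
  shows holomorphic_bifun_left: "y \<in> X \<Longrightarrow> vec_holomorphic_on (\<lambda>x. L x y) X"
    and holomorphic_bifun_right: "y \<in> X \<Longrightarrow> vec_holomorphic_on (\<lambda>x. L y x) X"
    and holomorphic_bifun_diagonal: "vec_holomorphic_on (\<lambda>x. L x x) X"
  by (rule holomorphic_bifun_compose[OF assms]; (rule has_derivative_const has_derivative_ident)?; simp)+

lemma holomorphic_bifun_imp_continuous_on:
  assumes "holomorphic_bifun X L" "continuous_on S g" "continuous_on S k"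
    "g ` S \<subseteq> X" "k ` S \<subseteq> X"
  shows "continuous_on S (\<lambda>p. L (g p) (k p))"
proof -
  have "continuous_on (X \<times> X) (\<lambda>(u, v). L u v)"
    using assms(1) unfolding holomorphic_bifun_def
    by (intro continuous_at_imp_continuous_on ballI) (metis SigmaE has_derivative_continuous)
  from continuous_on_compose2[OF this continuous_on_Pair[OF assms(2,3)]] assms(4,5)
  show ?thesis by auto
qed

section \<open>Construction of the rescaling factor\<close>

lemma cross_ratio_squares_imp_rescaling:
  fixes X :: "(complex ^ 'n) set"
  assumes X: "open X" "connected X" "X \<noteq> {}"
    and L: "holomorphic_bifun X L" "nondegenerate_bifun X L"
    and M: "holomorphic_bifun X M" "nondegenerate_bifun X M"
    and sq: "\<And>x y. x \<in> X \<Longrightarrow> y \<in> X \<Longrightarrow> (M x y)\<^sup>2 = M x x / L x x * (M y y / L y y) * (L x y)\<^sup>2"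
  shows "symmetric_rescalings X L M"
proof -
  obtain a where a: "a \<in> X" using X(3) by blast
  \<comment> \<open>On the diagonal, a rescaling factor \<open>f\<close> must satisfy
    \<open>h x = (f x)\<^sup>2\<close>.\<close>
  define h where "h x = M x x / L x x" for x
  have h: "h x \<noteq> 0" if "x \<in> X" for x
    using L(2) M(2) that by (auto simp: nondegenerate_bifun_def h_def)
  have sq: "(M x y)\<^sup>2 = h x * h y * (L x y)\<^sup>2" if "x \<in> X" "y \<in> X" for x y
    using sq[OF that] by (simp add: h_def)
  have M0: "M x y = 0 \<longleftrightarrow> L x y = 0" if "x \<in> X" "y \<in> X" for x y
  proof -
    have "(M x y)\<^sup>2 = 0 \<longleftrightarrow> (L x y)\<^sup>2 = 0"
      unfolding sq[OF that] using h that by simp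
    then show ?thesis by simp
  qed
  \<comment> \<open>\<open>A = B\<close> is the rescaling identity with denominators cleared;
    \<open>z\<close> is the auxiliary point for \<open>f x\<close>, and \<open>w\<close> the one for
    \<open>f y\<close>.\<close>
  define A where "A x y z w = M x y * (M a z * L x z) * (M a w * L y w)" for x y z w
  define B where "B x y z w = h a * (M x z * L a z) * (M y w * L a w) * L x y" for x y z w
  have AB: "(A x y z w)\<^sup>2 = (B x y z w)\<^sup>2" if "x \<in> X" "y \<in> X" "z \<in> X" "w \<in> X" for x y z w
    using that a by (simp only: A_def B_def power_mult_distrib sq) (simp add: power2_eq_square mult_ac)
  define C where "C = X \<times> X \<times> X \<times> X"
  \<comment> \<open>Where \<open>s\<close> is nonzero, \<open>A = - B\<close> is excluded. At
    \<open>(a, a, a, a)\<close> both terms equal \<open>M a a ^ 3 * L a a ^ 2\<close>.\<close>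
  define s where "s = (\<lambda>(x, y, z, w). A x y z w + B x y z w)"
  have "continuous_on C s"
    unfolding s_def A_def B_def case_prod_unfold
    by (intro continuous_intros holomorphic_bifun_imp_continuous_on[OF L(1)]
        holomorphic_bifun_imp_continuous_on[OF M(1)]) (auto simp: C_def a)
  then have "open (C \<inter> s -` (- {0}))"
    using X(1) by (intro continuous_open_preimage) (auto simp: C_def open_Times)
  moreover have "(a, a, a, a) \<in> C \<inter> s -` (- {0})"
    using L(2) M(2) a by (simp add: C_def s_def A_def B_def h_def nondegenerate_bifun_def)
  ultimately obtain N1 P1 where 1: "open N1" "open P1" "a \<in> N1" "(a, a, a) \<in> P1"
      "N1 \<times> P1 \<subseteq> C \<inter> s -` (- {0})"
    by (rule open_prod_elim) auto
  obtain N2 P2 where 2: "open N2" "open P2" "a \<in> N2" "(a, a) \<in> P2" "N2 \<times> P2 \<subseteq> P1"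
    using open_prod_elim[OF 1(2,4)] by (metis mem_Sigma_iff)
  obtain N3 N4 where 3: "open N3" "open N4" "a \<in> N3" "a \<in> N4" "N3 \<times> N4 \<subseteq> P2"
    using open_prod_elim[OF 2(2,4)] by (metis mem_Sigma_iff)
  have sub: "N1 \<times> N2 \<times> N3 \<times> N4 \<subseteq> C \<inter> s -` (- {0})"
    using 1(5) 2(5) 3(5) by blast
  \<comment> \<open>One neighbourhood of \<open>a\<close> serves all four variables, so the
    two-variable identity theorem applies to each pair.\<close>
  define N where "N = N1 \<inter> N2 \<inter> N3 \<inter> N4"
  have NX: "N \<subseteq> X" "somewhere_dense N"
  proof -
    have "a \<in> N" "open N" using 1 2 3 by (auto simp: N_def)
    then show "somewhere_dense N" by (intro open_imp_somewhere_dense) auto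
    show "N \<subseteq> X"
    proof
      fix x assume "x \<in> N"
      then have "(x, a, a, a) \<in> C" using sub 1 2 3 by (auto simp: N_def)
      then show "x \<in> X" by (simp add: C_def)
    qed
  qed
  have near: "A x y z w - B x y z w = 0" if "x \<in> N" "y \<in> N" "z \<in> N" "w \<in> N" for x y z w
  proof -
    have "(x, y, z, w) \<in> N1 \<times> N2 \<times> N3 \<times> N4" using that by (simp add: N_def)
    with sub have "s (x, y, z, w) \<noteq> 0" by blast
    then have "A x y z w + B x y z w \<noteq> 0" by (simp add: s_def)
    moreover have "(A x y z w)\<^sup>2 = (B x y z w)\<^sup>2" using AB that NX(1) by blast
    ultimately show ?thesis by (auto simp: power2_eq_iff)
  qed
  note hol = vec_holomorphic_intros holomorphic_bifun_left[OF L(1)] holomorphic_bifun_right[OF L(1)]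
    holomorphic_bifun_left[OF M(1)] holomorphic_bifun_right[OF M(1)]
  \<comment> \<open>First \<open>z\<close> and \<open>w\<close> are released from \<open>N\<close>
    to \<open>X\<close>, then \<open>x\<close> and \<open>y\<close>.\<close>
  have step: "A x y z w - B x y z w = 0" if "x \<in> N" "y \<in> N" "z \<in> X" "w \<in> X" for x y z w
  proof (rule vec_identity_theorem_2[where F = "\<lambda>z w. A x y z w - B x y z w", OF X(1,2) NX])
    have xy: "x \<in> X" "y \<in> X" using that NX(1) by auto
    show "vec_holomorphic_on (\<lambda>z. A x y z w - B x y z w) X" if "w \<in> X" for w
      unfolding A_def B_def by (intro hol a xy that)
    show "vec_holomorphic_on (\<lambda>w. A x y z w - B x y z w) X" if "z \<in> X" for z
      unfolding A_def B_def by (intro hol a xy that)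
  qed (use that near in auto)
  have "A x y z w - B x y z w = 0" if "x \<in> X" "y \<in> X" "z \<in> X" "w \<in> X" for x y z w
  proof (rule vec_identity_theorem_2[where F = "\<lambda>x y. A x y z w - B x y z w", OF X(1,2) NX])
    show "vec_holomorphic_on (\<lambda>x. A x y z w - B x y z w) X" if "y \<in> X" for y
      unfolding A_def B_def by (intro hol a that \<open>z \<in> X\<close> \<open>w \<in> X\<close>)
    show "vec_holomorphic_on (\<lambda>y. A x y z w - B x y z w) X" if "x \<in> X" for x
      unfolding A_def B_def by (intro hol a that \<open>z \<in> X\<close> \<open>w \<in> X\<close>)
  qed (use that step in auto)
  then have eq: "A x y z w = B x y z w" if "x \<in> X" "y \<in> X" "z \<in> X" "w \<in> X" for x y z w
    using that by simp
  \<comment> \<open>By non-degeneracy \<open>L x\<close> is nonzero at \<open>x\<close> and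
    \<open>L a\<close> at \<open>a\<close>; with no zero divisors, both are nonzero at a common
    point.\<close>
  have "\<exists>z\<in>X. L x z \<noteq> 0 \<and> L a z \<noteq> 0" if "x \<in> X" for x
    using L(2) that a unfolding nondegenerate_bifun_def
    by (intro vec_holomorphic_mult_nonzero[OF X(1,2), of _ _ x a] hol) auto
  then obtain \<zeta> where \<zeta>: "\<And>x. x \<in> X \<Longrightarrow> \<zeta> x \<in> X \<and> L x (\<zeta> x) \<noteq> 0 \<and> L a (\<zeta> x) \<noteq> 0"
    by metis
  define f where "f x = csqrt (h a) * (M x (\<zeta> x) * L a (\<zeta> x)) / (M a (\<zeta> x) * L x (\<zeta> x))" for x
  have den: "M a (\<zeta> x) * L x (\<zeta> x) \<noteq> 0" if "x \<in> X" for x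
    using \<zeta>[OF that] M0 a by simp
  have "f x \<noteq> 0" if "x \<in> X" for x
    using \<zeta>[OF that] M0 a that h by (simp add: f_def)
  moreover have "M x y = f x * f y * L x y" if "x \<in> X" "y \<in> X" for x y
  proof -
    \<comment> \<open>The root enters once through \<open>f x\<close> and once through
      \<open>f y\<close>, so only its square \<open>h a\<close> remains.\<close>
    have "csqrt (h a) * csqrt (h a) = h a"
      by (metis power2_csqrt power2_eq_square)
    then have "f x * f y * L x y = B x y (\<zeta> x) (\<zeta> y) /
        ((M a (\<zeta> x) * L x (\<zeta> x)) * (M a (\<zeta> y) * L y (\<zeta> y)))"
      unfolding f_def B_def times_divide_times_eq times_divide_eq_left by (simp add: mult_ac)
    also have "\<dots> = A x y (\<zeta> x) (\<zeta> y) /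
        ((M a (\<zeta> x) * L x (\<zeta> x)) * (M a (\<zeta> y) * L y (\<zeta> y)))"
      using eq[of x y "\<zeta> x" "\<zeta> y"] that \<zeta> by simp
    also have "\<dots> = M x y"
      using den[OF that(1)] den[OF that(2)] by (simp add: A_def)
    finally show ?thesis by simp
  qed
  ultimately show ?thesis unfolding symmetric_rescalings_def by blast
qed

section \<open>Spreading the squared identity from a somewhere dense set\<close>

theorem proposition5p4:
  fixes X :: "(complex ^ 'n) set"
    and L M :: "complex ^ 'n \<Rightarrow> complex ^ 'n \<Rightarrow> complex"
  assumes "is_domain X"
    and "holomorphic_bifun X L" and "nondegenerate_bifun X L"
    and "holomorphic_bifun X M" and "nondegenerate_bifun X M"
  shows "symmetric_rescalings X L M \<longleftrightarrow>
    (\<exists>U. U \<subseteq> X \<and> somewhere_dense U \<and>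
      (\<forall>x\<in>U. \<forall>y\<in>U. (L x y)\<^sup>2 / (L x x * L y y) = (M x y)\<^sup>2 / (M x x * M y y)))"
proof
  have X: "open X" "connected X" "X \<noteq> {}"
    using assms(1) by (auto simp: is_domain_def)
  have nz: "L x x \<noteq> 0" "M x x \<noteq> 0" if "x \<in> X" for x
    using assms(3,5) that by (auto simp: nondegenerate_bifun_def)
  {
    assume "symmetric_rescalings X L M"
    then obtain f where f: "\<And>x. x \<in> X \<Longrightarrow> f x \<noteq> 0"
        "\<And>x y. x \<in> X \<Longrightarrow> y \<in> X \<Longrightarrow> M x y = f x * f y * L x y"
      unfolding symmetric_rescalings_def by blast
    have "(L x y)\<^sup>2 / (L x x * L y y) = (M x y)\<^sup>2 / (M x x * M y y)" if "x \<in> X" "y \<in> X" for x y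
      using that f(1)[of x] f(1)[of y] nz(1)[of x] nz(1)[of y]
      by (simp add: f(2) field_simps power2_eq_square)
    then show "\<exists>U. U \<subseteq> X \<and> somewhere_dense U \<and>
        (\<forall>x\<in>U. \<forall>y\<in>U. (L x y)\<^sup>2 / (L x x * L y y) = (M x y)\<^sup>2 / (M x x * M y y))"
      \<comment> \<open>The witness is \<open>U = X\<close>.\<close>
      using open_imp_somewhere_dense[OF X(1,3)] by blast
  next
    assume "\<exists>U. U \<subseteq> X \<and> somewhere_dense U \<and>
      (\<forall>x\<in>U. \<forall>y\<in>U. (L x y)\<^sup>2 / (L x x * L y y) = (M x y)\<^sup>2 / (M x x * M y y))"
    then obtain U where U: "U \<subseteq> X" "somewhere_dense U" and
      eq: "\<And>x y. x \<in> U \<Longrightarrow> y \<in> U \<Longrightarrow> (L x y)\<^sup>2 / (L x x * L y y) = (M x y)\<^sup>2 / (M x x * M y y)"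
      by blast
    \<comment> \<open>Cross-multiplying avoids quotients; the diagonal factors are holomorphic too,
      so \<open>F\<close> is holomorphic in each argument.\<close>
    define F where "F x y = (M x y)\<^sup>2 * (L x x * L y y) - (L x y)\<^sup>2 * (M x x * M y y)" for x y
    note hol = vec_holomorphic_intros
      holomorphic_bifun_left[OF assms(2)] holomorphic_bifun_right[OF assms(2)]
      holomorphic_bifun_left[OF assms(4)] holomorphic_bifun_right[OF assms(4)]
      holomorphic_bifun_diagonal[OF assms(2)] holomorphic_bifun_diagonal[OF assms(4)]
    have F0: "F x y = 0" if "x \<in> X" "y \<in> X" for x y
    proof (rule vec_identity_theorem_2[where F = F, OF X(1,2) U])
      show "F x y = 0" if "x \<in> U" "y \<in> U" for x y
      proof -
        have "x \<in> X" "y \<in> X" using that U(1) by auto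
        with eq[OF that] nz[of x] nz[of y] show ?thesis
          by (simp add: F_def frac_eq_eq)
      qed
      show "vec_holomorphic_on (\<lambda>x. F x y) X" if "y \<in> X" for y
        unfolding F_def by (intro hol that)
      show "vec_holomorphic_on (\<lambda>y. F x y) X" if "x \<in> X" for x
        unfolding F_def by (intro hol that)
    qed fact+
    have "(M x y)\<^sup>2 = M x x / L x x * (M y y / L y y) * (L x y)\<^sup>2" if "x \<in> X" "y \<in> X" for x y
    proof -
      have "(M x y)\<^sup>2 * (L x x * L y y) = (M x x * M y y) * (L x y)\<^sup>2"
        using F0[OF that] by (simp add: F_def mult.commute)
      then have "(M x y)\<^sup>2 = (M x x * M y y) * (L x y)\<^sup>2 / (L x x * L y y)"
        using nz(1) that by (subst nonzero_eq_divide_eq) simp_all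
      then show ?thesis by simp
    qed
    then show "symmetric_rescalings X L M"
      by (rule cross_ratio_squares_imp_rescaling[OF X assms(2,3,4,5)])
  }
qed

end
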